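(* Let $0\le\delta\le\epsilon\le\frac13$ with $\epsilon>0$, let $D_{\mathcal X^n}$ be a probability distribution on $\mathcal X^n$, and let $q$ be a query. If a mechanism $M:\mathcal X^n\times\mathcal Q\to\mathcal R$ satisfies $(\epsilon,\delta)$-Local-Max-Information (LMI) with respect to $D_{\mathcal X^n}$ and $q$, then it is $\left(\epsilon',\frac\delta\epsilon\right)$-LSS with respect to the same $D_{\mathcal X^n}$ and $q$, where $\epsilon'=e^\epsilon-1+\epsilon$.
   Context: $\mathcal X$, $\mathcal Q$, $\mathcal R$ are countable sets and $n\in\mathbb N$. A mechanism is a possibly randomized function $M:\mathcal X^n\times\mathcal Q\to\mathcal R$; for fixed $q$ write $D(r\mid s)=\Pr[M(s,q)=r]$. Induced distributions: $D(s)=D_{\mathcal X^n}(s)$, $D(r)=\sum_sD(s)D(r\mid s)$, $D(s\mid r)=D(s)D(r\mid s)/D(r)$, $D(x\mid s)=\frac1n|\{i:s_i=x\}|$, $D(x)=\sum_sD(s)D(x\mid s)$, $D(x\mid r)=\sum_sD(s\mid r)D(x\mid s)$ (for $r$ with $D(r)>0$; only these matter). On $\mathcal X\times\mathcal R$: joint $D_{(\mathcal X,\mathcal R)}(x,r)=\sum_sD(s)D(x\mid s)D(r\mid s)$ and product $D_{\mathcal X\otimes\mathcal R}(x,r)=D(x)D(r)$. Local Max Information: $M$ satisfies $(\epsilon,\delta)$-LMI with respect to $D_{\mathcal X^n},q$ if for every $\mathbf b\subseteq\mathcal X\times\mathcal R$, $D_{(\mathcal X,\mathcal R)}(\mathbf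 b)\le e^\epsilon D_{\mathcal X\otimes\mathcal R}(\mathbf b)+\delta$ and $D_{\mathcal X\otimes\mathcal R}(\mathbf b)\le e^\epsilon D_{(\mathcal X,\mathcal R)}(\mathbf b)+\delta$. LSS (Local Statistical Stability): with stability loss $\ell(r)=\sum_{x:\,D(x\mid r)>D(x)}(D(x\mid r)-D(x))$, $M$ is $(\epsilon,\delta)$-LSS with respect to $D_{\mathcal X^n},q$ if for every $\mathbf r\subseteq\mathcal R$, $\sum_{r\in\mathbf r}D(r)(\ell(r)-\epsilon)\le\delta$. *)

theory Defs
  imports "HOL-Probability.Probability"
begin

text \<open>
  The countable sets X, Q, R are types \<open>'x\<close>, \<open>'q\<close>, \<open>'r\<close> of class \<open>countable\<close>.  A distribution on
  \<open>'x\<^sup>n\<close> is an \<open>'x list pmf\<close> supported on \<open>samples n\<close>; a mechanism has type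
  \<open>'x list \<Rightarrow> 'q \<Rightarrow> 'r pmf\<close>, and its values on lists outside \<open>samples n\<close> are never used.

  When D is such a distribution, every family summed below is absolutely summable, so the
  convention that \<open>infsum\<close> is 0 on non-summable families plays no role.
\<close>

definition samples :: "nat \<Rightarrow> 'x list set" where
  "samples n = {s. length s = n}"

definition elem_given_sample :: "nat \<Rightarrow> 'x \<Rightarrow> 'x list \<Rightarrow> real" where
  "elem_given_sample n x s = real (card {i. i < n \<and> s ! i = x}) / real n"

definition resp_prob ::
  "nat \<Rightarrow> 'x list pmf \<Rightarrow> ('x list \<Rightarrow> 'q \<Rightarrow> 'r pmf) \<Rightarrow> 'q \<Rightarrow> 'r \<Rightarrow> real" where
  "resp_prob n D M q r = (\<Sum>\<^sub>\<infinity>s\<in>samples n. pmf D s * pmf (M s q) r)"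

text \<open>
  For a response of probability 0 this is \<open>_ / 0 = 0\<close>; such responses carry weight 0 in
  \<open>local_statistical_stability\<close>.
\<close>

definition sample_given_resp ::
  "nat \<Rightarrow> 'x list pmf \<Rightarrow> ('x list \<Rightarrow> 'q \<Rightarrow> 'r pmf) \<Rightarrow> 'q \<Rightarrow> 'x list \<Rightarrow> 'r \<Rightarrow> real" where
  "sample_given_resp n D M q s r = pmf D s * pmf (M s q) r / resp_prob n D M q r"

definition elem_prob :: "nat \<Rightarrow> 'x list pmf \<Rightarrow> 'x \<Rightarrow> real" where
  "elem_prob n D x = (\<Sum>\<^sub>\<infinity>s\<in>samples n. pmf D s * elem_given_sample n x s)"

definition elem_given_resp ::
  "nat \<Rightarrow> 'x list pmf \<Rightarrow> ('x list \<Rightarrow> 'q \<Rightarrow> 'r pmf) \<Rightarrow> 'q \<Rightarrow> 'x \<Rightarrow> 'r \<Rightarrow> real" where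
  "elem_given_resp n D M q x r =
     (\<Sum>\<^sub>\<infinity>s\<in>samples n. sample_given_resp n D M q s r * elem_given_sample n x s)"

definition joint_point ::
  "nat \<Rightarrow> 'x list pmf \<Rightarrow> ('x list \<Rightarrow> 'q \<Rightarrow> 'r pmf) \<Rightarrow> 'q \<Rightarrow> 'x \<Rightarrow> 'r \<Rightarrow> real" where
  "joint_point n D M q x r =
     (\<Sum>\<^sub>\<infinity>s\<in>samples n. pmf D s * elem_given_sample n x s * pmf (M s q) r)"

definition joint_prob ::
  "nat \<Rightarrow> 'x list pmf \<Rightarrow> ('x list \<Rightarrow> 'q \<Rightarrow> 'r pmf) \<Rightarrow> 'q \<Rightarrow> ('x \<times> 'r) set \<Rightarrow> real" where
  "joint_prob n D M q B = (\<Sum>\<^sub>\<infinity>(x, r)\<in>B. joint_point n D M q x r)"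

definition product_prob ::
  "nat \<Rightarrow> 'x list pmf \<Rightarrow> ('x list \<Rightarrow> 'q \<Rightarrow> 'r pmf) \<Rightarrow> 'q \<Rightarrow> ('x \<times> 'r) set \<Rightarrow> real" where
  "product_prob n D M q B = (\<Sum>\<^sub>\<infinity>(x, r)\<in>B. elem_prob n D x * resp_prob n D M q r)"

definition local_max_information ::
  "real \<Rightarrow> real \<Rightarrow> nat \<Rightarrow> 'x list pmf \<Rightarrow> ('x list \<Rightarrow> 'q \<Rightarrow> 'r pmf) \<Rightarrow> 'q \<Rightarrow> bool" where
  "local_max_information \<epsilon> \<delta> n D M q \<longleftrightarrow>
     (\<forall>B. joint_prob n D M q B \<le> exp \<epsilon> * product_prob n D M q B + \<delta> \<and>
          product_prob n D M q B \<le> exp \<epsilon> * joint_prob n D M q B + \<delta>)"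

definition stability_loss ::
  "nat \<Rightarrow> 'x list pmf \<Rightarrow> ('x list \<Rightarrow> 'q \<Rightarrow> 'r pmf) \<Rightarrow> 'q \<Rightarrow> 'r \<Rightarrow> real" where
  "stability_loss n D M q r =
     (\<Sum>\<^sub>\<infinity>x\<in>{x. elem_given_resp n D M q x r > elem_prob n D x}.
        elem_given_resp n D M q x r - elem_prob n D x)"

definition local_statistical_stability ::
  "real \<Rightarrow> real \<Rightarrow> nat \<Rightarrow> 'x list pmf \<Rightarrow> ('x list \<Rightarrow> 'q \<Rightarrow> 'r pmf) \<Rightarrow> 'q \<Rightarrow> bool" where
  "local_statistical_stability \<epsilon> \<delta> n D M q \<longleftrightarrow>
     (\<forall>A. (\<Sum>\<^sub>\<infinity>r\<in>A. resp_prob n D M q r * (stability_loss n D M q r - \<epsilon>)) \<le> \<delta>)"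

end

theory Submission imports Defs begin

text \<open>
  Draw a sample \<open>s\<close> from \<open>D\<close>, a uniformly random entry \<open>x\<close> of \<open>s\<close> and, independently given \<open>s\<close>, a
  response \<open>r\<close>.  This gives a joint distribution \<open>J\<close> of \<open>(x, r)\<close> with marginals \<open>P\<close> and \<open>R\<close>.  The
  stability loss weighted by \<open>R r\<close> is the sum over \<open>x\<close> of the positive part of
  \<open>J (x, r) - P x * R r\<close>, so summing it over \<open>r \<in> A\<close> gives \<open>J(B) - (P \<otimes> R)(B)\<close> for the set \<open>B\<close> of
  pairs with \<open>r \<in> A\<close> and \<open>J (x, r) > P x * R r\<close>.  By local max information this is at most
  \<open>(exp \<epsilon> - 1) * (P \<otimes> R)(B) + \<delta> \<le> (exp \<epsilon> - 1) * R(A) + \<delta>\<close>.  Hence even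
  \<open>(exp \<epsilon> - 1, \<delta>)\<close>-stability holds, and \<open>\<delta> \<le> \<delta> / \<epsilon>\<close>.
\<close>

lemma has_sum_diff:
  fixes f g :: "'a \<Rightarrow> 'b::real_normed_vector"
  assumes "(f has_sum a) A" and "(g has_sum b) A"
  shows "((\<lambda>x. f x - g x) has_sum (a - b)) A"
  using has_sum_add[OF assms(1), of "\<lambda>x. - g x" "- b"] assms(2) by (simp add: has_sum_uminus)

lemma summable_on_pmf: "pmf p summable_on A"
  by (metis abs_summable_equivalent abs_summable_summable pmf_abs_summable)

lemma infsum_pmf_eq_measure: "(\<Sum>\<^sub>\<infinity>x\<in>A. pmf p x) = measure_pmf.prob p A"
  by (simp add: measure_pmf_conv_infsetsum infsetsum_infsum pmf_abs_summable)

text \<open>Links the sums over \<open>samples n\<close> in the definitions to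
  \<open>pmf_bind\<close>, which yields expectations. Boundedness of \<open>f\<close> makes the
  family absolutely summable by comparison with \<open>C * pmf p x\<close>, and the terms outside
  \<open>S\<close> vanish because \<open>S\<close> contains the support.\<close>

lemma infsum_pmf_times_eq_expectation:
  fixes f :: "'a \<Rightarrow> real"
  assumes "set_pmf p \<subseteq> S" and bound: "\<And>x. \<bar>f x\<bar> \<le> C"
  shows "(\<Sum>\<^sub>\<infinity>x\<in>S. pmf p x * f x) = measure_pmf.expectation p f"
proof -
  have "Infinite_Set_Sum.abs_summable_on (\<lambda>x. pmf p x * f x) UNIV"
  proof (rule abs_summable_on_comparison_test)
    show "Infinite_Set_Sum.abs_summable_on (\<lambda>x. C * pmf p x) UNIV"
      by (intro abs_summable_on_cmult_right pmf_abs_summable)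
    show "norm (pmf p x * f x) \<le> norm (C * pmf p x)" for x
      using mult_left_mono[OF order.trans[OF bound[of x] abs_ge_self], of "pmf p x"]
      by (simp add: abs_mult mult.commute)
  qed
  then have "measure_pmf.expectation p f = (\<Sum>\<^sub>\<infinity>x\<in>UNIV. pmf p x * f x)"
    by (simp add: pmf_expectation_eq_infsetsum infsetsum_infsum)
  also have "\<dots> = (\<Sum>\<^sub>\<infinity>x\<in>S. pmf p x * f x)"
    using assms(1) by (intro infsum_cong_neutral) (auto simp: set_pmf_iff)
  finally show ?thesis ..
qed

lemma pmf_le_pmf_map_snd: "pmf p (x, r) \<le> pmf (map_pmf snd p) r"
  unfolding pmf_map unfolding measure_pmf_single[symmetric]
  by (rule measure_pmf.finite_measure_mono) auto

text \<open>The law of a uniformly drawn entry. The index set is nonempty, and so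
  \<open>pmf_of_set\<close> meaningful, only for n \<ge> 1.\<close>

definition entry_pmf :: "nat \<Rightarrow> 'x list \<Rightarrow> 'x pmf" where
  "entry_pmf n s = map_pmf (nth s) (pmf_of_set {..<n})"

definition elem_pmf :: "nat \<Rightarrow> 'x list pmf \<Rightarrow> 'x pmf" where
  "elem_pmf n D = D \<bind> entry_pmf n"

definition resp_pmf :: "'x list pmf \<Rightarrow> ('x list \<Rightarrow> 'q \<Rightarrow> 'r pmf) \<Rightarrow> 'q \<Rightarrow> 'r pmf" where
  "resp_pmf D M q = D \<bind> (\<lambda>s. M s q)"

definition joint_pmf ::
  "nat \<Rightarrow> 'x list pmf \<Rightarrow> ('x list \<Rightarrow> 'q \<Rightarrow> 'r pmf) \<Rightarrow> 'q \<Rightarrow> ('x \<times> 'r) pmf" where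
  "joint_pmf n D M q = D \<bind> (\<lambda>s. pair_pmf (entry_pmf n s) (M s q))"

lemma pmf_entry_pmf:
  assumes "n \<ge> 1"
  shows "pmf (entry_pmf n s) x = elem_given_sample n x s"
proof -
  have "{..<n} \<inter> nth s -` {x} = {i. i < n \<and> s ! i = x}" by auto
  moreover have "{..<n} \<noteq> {}" using assms by (auto simp: lessThan_empty_iff)
  ultimately show ?thesis
    by (simp add: entry_pmf_def elem_given_sample_def pmf_map measure_pmf_of_set)
qed

lemma map_snd_joint_pmf: "map_pmf snd (joint_pmf n D M q) = resp_pmf D M q"
  by (simp add: joint_pmf_def resp_pmf_def map_bind_pmf map_snd_pair_pmf)

context
  fixes n :: nat and D :: "'x list pmf"
  assumes n: "n \<ge> 1" and D: "set_pmf D \<subseteq> samples n"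
begin

lemma resp_prob_eq_pmf: "resp_prob n D M q r = pmf (resp_pmf D M q) r"
  unfolding resp_prob_def resp_pmf_def pmf_bind
  by (rule infsum_pmf_times_eq_expectation[OF D, where C = 1]) (simp add: pmf_le_1)

lemma elem_prob_eq_pmf: "elem_prob n D x = pmf (elem_pmf n D) x"
  unfolding elem_prob_def elem_pmf_def pmf_bind pmf_entry_pmf[OF n, symmetric]
  by (rule infsum_pmf_times_eq_expectation[OF D, where C = 1]) (simp add: pmf_le_1)

lemma joint_point_eq_pmf: "joint_point n D M q x r = pmf (joint_pmf n D M q) (x, r)"
  unfolding joint_point_def joint_pmf_def pmf_bind pmf_pair pmf_entry_pmf[OF n, symmetric]
    mult.assoc
  by (rule infsum_pmf_times_eq_expectation[OF D, where C = 1])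
     (simp add: abs_mult pmf_le_1 mult_le_one)

lemma joint_prob_eq_measure: "joint_prob n D M q B = measure_pmf.prob (joint_pmf n D M q) B"
  by (simp add: joint_prob_def joint_point_eq_pmf infsum_pmf_eq_measure)

lemma product_prob_eq_measure:
  "product_prob n D M q B = measure_pmf.prob (pair_pmf (elem_pmf n D) (resp_pmf D M q)) B"
  unfolding product_prob_def infsum_pmf_eq_measure[symmetric]
  by (rule infsum_cong) (auto simp: pmf_pair resp_prob_eq_pmf elem_prob_eq_pmf)

text \<open>Bayes' rule with the division cleared. For a null response the quotient is only a
  default value, but the joint mass is bounded by its marginal, so both sides are 0.\<close>

lemma resp_prob_times_elem_given_resp:
  "resp_prob n D M q r * elem_given_resp n D M q x r = joint_point n D M q x r"
proof (cases "resp_prob n D M q r = 0")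
  case True
  then have "joint_point n D M q x r = 0"
    using pmf_le_pmf_map_snd[of "joint_pmf n D M q" x r]
    by (simp add: joint_point_eq_pmf resp_prob_eq_pmf map_snd_joint_pmf)
  with True show ?thesis by simp
next
  case False
  then show ?thesis
    unfolding elem_given_resp_def joint_point_def infsum_cmult_right'[symmetric]
    by (intro infsum_cong) (simp add: sample_given_resp_def)
qed

text \<open>Scaling by a positive response probability preserves the strict inequality that selects
  the elements, so both index sets agree. For a null response the right-hand index set is
  empty.\<close>

lemma resp_prob_times_stability_loss:
  "resp_prob n D M q r * stability_loss n D M q r =
    (\<Sum>\<^sub>\<infinity>x\<in>{x. joint_point n D M q x r > elem_prob n D x * resp_prob n D M q r}.
       joint_point n D M q x r - elem_prob n D x * resp_prob n D M q r)"
proof (cases "resp_prob n D M q r = 0")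
  case True
  then have "joint_point n D M q x r = 0" for x
    by (simp flip: resp_prob_times_elem_given_resp)
  with True show ?thesis by simp
next
  case False
  then have "resp_prob n D M q r > 0"
    by (simp add: resp_prob_eq_pmf order.strict_iff_order)
  then have "joint_point n D M q x r > elem_prob n D x * resp_prob n D M q r \<longleftrightarrow>
      elem_given_resp n D M q x r > elem_prob n D x" for x
    by (simp add: mult.commute[of "elem_prob n D x"] flip: resp_prob_times_elem_given_resp)
  then show ?thesis
    unfolding stability_loss_def infsum_cmult_right'[symmetric]
    by (intro infsum_cong_neutral)
       (auto simp: algebra_simps simp flip: resp_prob_times_elem_given_resp)
qed

lemma local_max_information_imp_stability:
  assumes lmi: "local_max_information \<epsilon> \<delta> n D M q" and "0 \<le> \<epsilon>" and "exp \<epsilon> - 1 \<le> \<epsilon>'"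
  shows "local_statistical_stability \<epsilon>' \<delta> n D M q"
  unfolding local_statistical_stability_def
proof
  fix A
  let ?J = "joint_pmf n D M q" and ?R = "resp_pmf D M q"
  let ?Q = "pair_pmf (elem_pmf n D) ?R"
  \<comment> \<open>\<open>L r\<close> is the slice of \<open>B\<close> at \<open>r\<close>.
    \<open>Sigma A L\<close> lists the response first so that the sum over \<open>r\<close> becomes
    the outer one, whereas \<open>?J\<close> and \<open>?Q\<close> live on pairs (x, r); hence the
    swap.\<close>
  define L where "L r = {x. pmf ?J (x, r) > pmf ?Q (x, r)}" for r
  define g where "g = (\<lambda>(r, x). pmf ?J (x, r) - pmf ?Q (x, r))"
  define B where "B = prod.swap ` Sigma A L"
  have loss: "resp_prob n D M q r * stability_loss n D M q r = (\<Sum>\<^sub>\<infinity>x\<in>L r. g (r, x))" for r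
    unfolding resp_prob_times_stability_loss
    by (simp add: L_def g_def joint_point_eq_pmf resp_prob_eq_pmf elem_prob_eq_pmf pmf_pair)
  have J: "((\<lambda>z. pmf ?J z) has_sum measure_pmf.prob ?J B) B"
    and Q: "((\<lambda>z. pmf ?Q z) has_sum measure_pmf.prob ?Q B) B"
    by (simp_all add: has_sum_iff summable_on_pmf infsum_pmf_eq_measure)
  have "((\<lambda>z. pmf ?J z - pmf ?Q z) has_sum (measure_pmf.prob ?J B - measure_pmf.prob ?Q B)) B"
    by (rule has_sum_diff[OF J Q])
  then have g: "(g has_sum (measure_pmf.prob ?J B - measure_pmf.prob ?Q B)) (Sigma A L)"
    unfolding B_def by (subst (asm) has_sum_reindex) (auto simp: g_def o_def case_prod_unfold prod.swap_def)
  then have g_summable: "g summable_on Sigma A L"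
    by (rule has_sum_imp_summable)
  \<comment> \<open>Fubini: summability over \<open>Sigma A L\<close> also gives summability of the
    inner sums over \<open>A\<close>, which is needed to subtract the \<epsilon>' term inside the
    sum.\<close>
  have "((\<lambda>r. \<Sum>\<^sub>\<infinity>x\<in>L r. g (r, x)) has_sum
      (measure_pmf.prob ?J B - measure_pmf.prob ?Q B)) A"
    using summable_on_Sigma_banach[of "curry g" A L] infsum_Sigma_banach[OF g_summable] infsumI[OF g]
      g_summable by (simp add: has_sum_iff curry_def)
  moreover have "((\<lambda>r. \<epsilon>' * pmf ?R r) has_sum (\<epsilon>' * measure_pmf.prob ?R A)) A"
    by (intro has_sum_cmult_right) (simp add: has_sum_iff summable_on_pmf infsum_pmf_eq_measure)
  ultimately have "((\<lambda>r. (\<Sum>\<^sub>\<infinity>x\<in>L r. g (r, x)) - \<epsilon>' * pmf ?R r) has_sum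
      (measure_pmf.prob ?J B - measure_pmf.prob ?Q B - \<epsilon>' * measure_pmf.prob ?R A)) A"
    by (rule has_sum_diff)
  then have "(\<Sum>\<^sub>\<infinity>r\<in>A. resp_prob n D M q r * (stability_loss n D M q r - \<epsilon>')) =
      measure_pmf.prob ?J B - measure_pmf.prob ?Q B - \<epsilon>' * measure_pmf.prob ?R A"
    unfolding right_diff_distrib[of "resp_prob _ _ _ _ _" "stability_loss _ _ _ _ _"] loss
    by (subst mult.commute) (simp add: resp_prob_eq_pmf infsumI)
  also have "\<dots> \<le> \<delta>"
  proof -
    have "measure_pmf.prob ?J B \<le> exp \<epsilon> * measure_pmf.prob ?Q B + \<delta>"
      using lmi by (simp add: local_max_information_def joint_prob_eq_measure
          product_prob_eq_measure)
    \<comment> \<open>\<open>B\<close> lies in the cylinder over \<open>A\<close>, whose product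
      measure is the response marginal of \<open>A\<close>.\<close>
    moreover have "measure_pmf.prob ?Q B \<le> measure_pmf.prob ?R A"
    proof -
      have "measure_pmf.prob ?Q B \<le> measure_pmf.prob ?Q (snd -` A)"
        by (rule measure_pmf.finite_measure_mono) (auto simp: B_def)
      also have "\<dots> = measure_pmf.prob (map_pmf snd ?Q) A"
        by simp
      finally show ?thesis by (simp only: map_snd_pair_pmf)
    qed
    then have "(exp \<epsilon> - 1) * measure_pmf.prob ?Q B \<le> \<epsilon>' * measure_pmf.prob ?R A"
      using assms(2,3) order.trans[of 0 "exp \<epsilon> - 1" \<epsilon>'] by (intro mult_mono) auto
    ultimately show ?thesis by (simp add: algebra_simps)
  qed
  finally show "(\<Sum>\<^sub>\<infinity>r\<in>A. resp_prob n D M q r * (stability_loss n D M q r - \<epsilon>')) \<le> \<delta>" .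
qed

end

theorem theorem4p12:
  fixes \<epsilon> \<delta> :: real and n :: nat
    and D :: "'x::countable list pmf"
    and M :: "'x list \<Rightarrow> 'q::countable \<Rightarrow> 'r::countable pmf"
    and q :: 'q
  assumes "0 \<le> \<delta>" and "\<delta> \<le> \<epsilon>" and "\<epsilon> \<le> 1 / 3" and "0 < \<epsilon>"
    and "n \<ge> 1"
    and "set_pmf D \<subseteq> samples n"
    and "local_max_information \<epsilon> \<delta> n D M q"
  shows "local_statistical_stability (exp \<epsilon> - 1 + \<epsilon>) (\<delta> / \<epsilon>) n D M q"
proof -
  have "local_statistical_stability (exp \<epsilon> - 1 + \<epsilon>) \<delta> n D M q"
    using assms by (intro local_max_information_imp_stability[where \<epsilon> = \<epsilon>]) auto
  moreover have "\<delta> \<le> \<delta> / \<epsilon>"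
    using assms mult_left_mono[of \<epsilon> 1 \<delta>] by (simp add: pos_le_divide_eq)
  ultimately show ?thesis
    unfolding local_statistical_stability_def by (meson order.trans)
qed

end
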